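(* Let $\delta,\alpha \ge 1$. Let $X$ be a $\delta$-dense multi-set of size $n$ that has no $\alpha$-almost divisor. Then there exists a subset $R\subseteq X$ such that (i) $|R| \le |X|\cdot 8\alpha\log(2n)/\delta$, (ii) $\Sigma(R) \le \Sigma(X)\cdot 8\alpha\log(2n)/\delta$, and (iii) for any integer $1 < d \le \alpha\cdot\mu_X\,\Sigma(X)/n^2$ the multi-set $R$ contains at least $d$ numbers not divisible by $d$, that is, $|\overline{R(d)}|\ge d$.
   Context: For a finite non-empty multi-set $X$ of positive integers: $|X|$ is the number of elements counted with multiplicity, $\max(X)$ its maximum element, $\mu_X$ the largest multiplicity of any number in $X$, $\Sigma(X)$ the sum of all elements (with multiplicity). $X$ is $\delta$-dense if $|X|^2\ge\delta\cdot\mu_X\cdot\max(X)$. For an integer $d$, $X(d) := X\cap d\mathbb{Z}$ and $\overline{X(d)} := X\setminus X(d)$ (same notation for $R$). An integer $d>1$ is an $\alpha$-almost divisor of $X$ if $|\overline{X(d)}|\le\alpha\cdot\mu_X\cdot\Sigma(X)/|X|^2$. A subset $R\subseteq X$ of a multi-set respects multiplicities. *)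

theory Defs
  imports Complex_Main "HOL-Library.Multiset"
begin

definition max_mult :: "'a multiset \<Rightarrow> nat" where
  "max_mult X = Max (count X ` set_mset X)"

definition dense :: "real \<Rightarrow> nat multiset \<Rightarrow> bool" where
  "dense \<delta> X \<longleftrightarrow> (real (size X))\<^sup>2 \<ge> \<delta> * real (max_mult X) * real (Max (set_mset X))"

definition multiples :: "nat multiset \<Rightarrow> nat \<Rightarrow> nat multiset" where
  "multiples X d = filter_mset (\<lambda>x. d dvd x) X"

definition nonmultiples :: "nat multiset \<Rightarrow> nat \<Rightarrow> nat multiset" where
  "nonmultiples X d = X - multiples X d"

definition almost_divisor :: "real \<Rightarrow> nat multiset \<Rightarrow> nat \<Rightarrow> bool" where
  "almost_divisor \<alpha> X d \<longleftrightarrow> d > 1 \<and>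
     real (size (nonmultiples X d))
       \<le> \<alpha> * real (max_mult X) * real (sum_mset X) / (real (size X))\<^sup>2"

end

theory Submission
  imports Defs "HOL-Computational_Algebra.Primes"
begin

text \<open>
  Put \<open>\<tau> = \<alpha> \<mu>\<^sub>X \<Sigma>(X) / n\<^sup>2\<close> and \<open>t = \<lfloor>\<tau>\<rfloor>\<close>. Density gives \<open>\<tau> max(X) \<le> \<alpha> \<Sigma>(X) / \<delta>\<close>, so that any
  subset with at most \<open>8 \<tau> log(2n)\<close> elements satisfies both size bounds. Start with an arbitrary
  subset \<open>R\<^sub>0\<close> of size \<open>2t\<close>. A prime \<open>p\<close> is bad if \<open>R\<^sub>0\<close> has at most \<open>t\<close> non-multiples of \<open>p\<close>;
  then \<open>p\<close> divides at least half of \<open>R\<^sub>0\<close>. As every \<open>x \<in> X\<close> is at most \<open>n\<^sup>2\<close>, it has at most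
  \<open>2 log n\<close> prime divisors, so by double counting there are at most \<open>4 log n\<close> bad primes. Since no
  prime is an almost divisor, \<open>t\<close> non-multiples of each bad prime can be added. Composite \<open>d \<le> t\<close>
  are handled by any of their prime factors.
\<close>

section \<open>Non-multiples and sub-multisets of prescribed size\<close>

lemma nonmultiples_eq_filter: "nonmultiples X d = filter_mset (\<lambda>x. \<not> d dvd x) X"
  unfolding nonmultiples_def multiples_def
  by (metis add_diff_cancel_left' multiset_partition)

text \<open>A non-multiple of \<open>p\<close> cannot be a multiple of \<open>d\<close> when
  \<open>p dvd d\<close>. This transfers bounds from a prime factor to \<open>d\<close>, and from a
  piece of the constructed set to the whole.\<close>

lemma size_nonmultiples_mono:
  assumes "A \<subseteq># B" "p dvd d"
  shows "size (nonmultiples A p) \<le> size (nonmultiples B d)"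
proof -
  have "nonmultiples A p \<subseteq># filter_mset (\<lambda>x. \<not> p dvd x) B"
    unfolding nonmultiples_eq_filter by (rule multiset_filter_mono[OF assms(1)])
  also have "\<dots> \<subseteq># nonmultiples B d"
    unfolding nonmultiples_eq_filter
    using assms(2) by (intro filter_mset_mono_strong) (auto dest: dvd_trans)
  finally show ?thesis by (rule size_mset_mono)
qed

lemma ex_submset_size:
  assumes "k \<le> size M"
  shows "\<exists>N. N \<subseteq># M \<and> size N = k"
  using assms
proof (induction M arbitrary: k)
  case empty
  then show ?case by simp
next
  case (add x M)
  show ?case
  proof (cases k)
    case 0
    then show ?thesis by auto
  next
    case (Suc j)
    then obtain N where "N \<subseteq># M" "size N = j" using add by auto
    then show ?thesis using Suc by (intro exI[of _ "add_mset x N"]) auto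
  qed
qed

lemma size_union_mset_le: "size (A \<union># B) \<le> size A + size B"
  by (metis mset_subset_eq_add_left mset_subset_eq_add_right size_mset_mono size_union
      subset_mset.sup_least)

text \<open>The pieces are merged by \<open>\<union>#\<close>, which takes maximal multiplicities,
  so the result stays inside \<open>X\<close>; a multiset sum might not. Passing to a witness
  \<open>S\<close> inside \<open>R\<close> avoids any monotonicity condition on
  \<open>Q\<close>.\<close>

lemma ex_mset_cover:
  assumes "finite P" "R0 \<subseteq># X" "\<And>p. p \<in> P \<Longrightarrow> \<exists>S. S \<subseteq># X \<and> size S \<le> t \<and> Q p S"
  shows "\<exists>R. R0 \<subseteq># R \<and> R \<subseteq># X \<and> size R \<le> size R0 + card P * t \<and>
    (\<forall>p\<in>P. \<exists>S. S \<subseteq># R \<and> Q p S)"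
  using assms(1,3)
proof (induction P rule: finite_induct)
  case empty
  then show ?case using assms(2) by auto
next
  case (insert p P)
  obtain R where R: "R0 \<subseteq># R" "R \<subseteq># X" "size R \<le> size R0 + card P * t"
      "\<forall>p\<in>P. \<exists>S. S \<subseteq># R \<and> Q p S"
    using insert.IH insert.prems by blast
  obtain S where S: "S \<subseteq># X" "size S \<le> t" "Q p S" using insert.prems by blast
  have "size (R \<union># S) \<le> size R0 + card (insert p P) * t"
    using size_union_mset_le[of R S] R(3) S(2) insert.hyps by simp
  moreover have "\<exists>S'. S' \<subseteq># R \<union># S \<and> Q q S'" if "q \<in> insert p P" for q
    using that R(4) S(3) by (metis insertE subset_mset.le_supI1 subset_mset.sup_ge2)
  ultimately show ?case using R(1,2) S(1)
    by (intro exI[of _ "R \<union># S"]) (auto intro: subset_mset.le_supI1)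
qed

section \<open>Double counting of prime divisors\<close>

lemma power_card_prime_divisors_le:
  fixes x :: nat
  assumes "finite P" "\<And>p. p \<in> P \<Longrightarrow> prime p \<and> p dvd x" "x > 0"
  shows "2 ^ card P \<le> x"
proof -
  \<comment> \<open>The product of the primes mediates: distinct primes are coprime, so it divides
    \<open>x\<close>, and each of its factors is at least 2.\<close>
  have "(\<Prod>P) dvd x \<and> 2 ^ card P \<le> \<Prod>P"
    using assms(1,2)
  proof (induction P rule: finite_induct)
    case empty
    then show ?case by simp
  next
    case (insert p P)
    have "coprime p (\<Prod>P)"
      using insert by (intro prod_coprime_right primes_coprime) auto
    then have "p * \<Prod>P dvd x" using insert by (intro divides_mult) auto
    moreover have "2 * 2 ^ card P \<le> p * \<Prod>P"
      using insert by (intro mult_mono prime_ge_2_nat) auto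
    ultimately show ?case using insert.hyps by simp
  qed
  then show ?thesis using assms(3) dvd_imp_le le_trans by blast
qed

text \<open>Both orders of summation count the pairs of some \<open>p\<close> in \<open>P\<close>
  and an occurrence of \<open>x\<close> in \<open>M\<close> with \<open>Q p x\<close>.\<close>

lemma sum_size_filter_le:
  fixes K :: real
  assumes "finite P" "\<And>x. x \<in># M \<Longrightarrow> real (card {p \<in> P. Q p x}) \<le> K"
  shows "real (\<Sum>p\<in>P. size (filter_mset (Q p) M)) \<le> real (size M) * K"
  using assms(2)
proof (induction M)
  case empty
  then show ?case by simp
next
  case (add x M)
  have "(\<Sum>p\<in>P. size (filter_mset (Q p) (add_mset x M))) =
      (\<Sum>p\<in>P. (if Q p x then 1 else 0) + size (filter_mset (Q p) M))"
    by (intro sum.cong) auto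
  also have "\<dots> = card {p \<in> P. Q p x} + (\<Sum>p\<in>P. size (filter_mset (Q p) M))"
    using assms(1) by (simp add: sum.distrib flip: sum.inter_filter)
  finally have "real (\<Sum>p\<in>P. size (filter_mset (Q p) (add_mset x M))) =
      real (card {p \<in> P. Q p x}) + real (\<Sum>p\<in>P. size (filter_mset (Q p) M))"
    by (simp only: of_nat_add)
  moreover have "real (\<Sum>p\<in>P. size (filter_mset (Q p) M)) \<le> real (size M) * K"
    using add by simp
  moreover have "real (card {p \<in> P. Q p x}) \<le> K" using add.prems by simp
  moreover have "real (size (add_mset x M)) * K = K + real (size M) * K"
    by (simp add: algebra_simps)
  ultimately show ?case by linarith
qed

lemma sum_mset_le_size_mult:
  fixes M :: "nat multiset"
  assumes "\<And>x. x \<in># M \<Longrightarrow> x \<le> b"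
  shows "sum_mset M \<le> size M * b"
  using assms by (induction M) (auto intro: add_mono)

text \<open>Each prime in \<open>P\<close> divides at least \<open>t\<close> of the
  \<open>2 * t\<close> elements, while each element has at most \<open>log 2 b\<close> prime
  divisors. Counting the divisibility pairs and cancelling \<open>t\<close> gives the bound.\<close>

lemma card_heavy_primes_le:
  fixes b :: real and t :: nat
  assumes "finite P" "\<And>p. p \<in> P \<Longrightarrow> prime p" "t > 0" "size M = 2 * t"
    and "\<And>x. x \<in># M \<Longrightarrow> x > 0 \<and> real x \<le> b"
    and "\<And>p. p \<in> P \<Longrightarrow> size (nonmultiples M p) \<le> t"
  shows "real (card P) \<le> 2 * log 2 b"
proof -
  have "real (card {p \<in> P. p dvd x}) \<le> log 2 b" if "x \<in># M" for x
  proof -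
    have "2 ^ card {p \<in> P. p dvd x} \<le> x"
      using assms that by (intro power_card_prime_divisors_le) auto
    then have "real (card {p \<in> P. p dvd x}) \<le> log 2 (real x)"
      by (intro le_log2_of_power)
    also have "\<dots> \<le> log 2 b" using assms(5)[OF that] by (subst log_le_cancel_iff) auto
    finally show ?thesis .
  qed
  then have "real (\<Sum>p\<in>P. size (filter_mset (\<lambda>x. p dvd x) M)) \<le> real (size M) * log 2 b"
    by (intro sum_size_filter_le assms(1))
  moreover have "card P * t \<le> (\<Sum>p\<in>P. size (filter_mset (\<lambda>x. p dvd x) M))"
  proof -
    have "t \<le> size (filter_mset (\<lambda>x. p dvd x) M)" if "p \<in> P" for p
    proof -
      have "size M = size (filter_mset (\<lambda>x. p dvd x) M) + size (nonmultiples M p)"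
        unfolding nonmultiples_eq_filter by (metis multiset_partition size_union)
      then show ?thesis using assms(4) assms(6)[OF that] by simp
    qed
    then show ?thesis using sum_bounded_below[of P t] by simp
  qed
  ultimately have "real (card P * t) \<le> real (2 * t) * log 2 b"
    unfolding assms(4) by linarith
  then have "real t * real (card P) \<le> real t * (2 * log 2 b)" by (simp add: algebra_simps)
  then show ?thesis using assms(3) by simp
qed

section \<open>Construction of the subset for an integer threshold\<close>

lemma ex_submset_many_nonmultiples:
  fixes t n :: nat
  assumes "size X = n" "n > 0" and bd: "\<And>x. x \<in># X \<Longrightarrow> x > 0 \<and> x \<le> n\<^sup>2"
    and many: "\<And>d. d > 1 \<Longrightarrow> t \<le> size (nonmultiples X d)"
  shows "\<exists>R. R \<subseteq># X \<and> real (size R) \<le> 4 * real t * log 2 (2 * real n) \<and>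
    (\<forall>d. 1 < d \<and> d \<le> t \<longrightarrow> d \<le> size (nonmultiples R d))"
proof -
  \<comment> \<open>The summand 1 makes the target at least \<open>4 * t\<close>, which settles the
    case of small \<open>X\<close> and later pays for the initial sample \<open>R0\<close>.\<close>
  have log_2n: "log 2 (2 * real n) = 1 + log 2 (real n)"
    using assms(2) by (simp add: log_mult)
  have log_n: "log 2 (real n) \<ge> 0" using assms(2) by simp
  consider "t = 0" | "t > 0" "n < 2 * t" | "t > 0" "2 * t \<le> n" by linarith
  then show ?thesis
  proof cases
    case 1
    then show ?thesis by (intro exI[of _ "{#}"]) auto
  next
    case 2
    have "real n \<le> 4 * real t * 1" using 2 by simp
    also have "\<dots> \<le> 4 * real t * log 2 (2 * real n)"
      using log_2n log_n by (intro mult_left_mono) auto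
    finally show ?thesis using assms(1) many by (intro exI[of _ X]) (auto intro: order_trans)
  next
    case 3
    obtain R0 where R0: "R0 \<subseteq># X" "size R0 = 2 * t"
      using ex_submset_size[of "2 * t" X] 3 assms(1) by auto
    \<comment> \<open>Only primes up to \<open>t\<close> occur as factors of the relevant
      \<open>d\<close>; this cutoff also makes \<open>B\<close> finite.\<close>
    define B where "B = {p. prime p \<and> p \<le> t \<and> size (nonmultiples R0 p) \<le> t}"
    have finB: "finite B" by (rule finite_subset[of _ "{..t}"]) (auto simp: B_def)
    have "real (card B) \<le> 2 * log 2 ((real n)\<^sup>2)"
    proof (rule card_heavy_primes_le[OF finB _ 3(1) R0(2)])
      show "x > 0 \<and> real x \<le> (real n)\<^sup>2" if "x \<in># R0" for x
        using bd[OF mset_subset_eqD[OF R0(1) that]] by (metis of_nat_le_iff of_nat_power)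
    qed (auto simp: B_def)
    then have cardB: "real (card B) \<le> 4 * log 2 (real n)"
      using assms(2) by (simp add: log_nat_power)
    have "\<exists>S. S \<subseteq># X \<and> size S \<le> t \<and> t \<le> size (nonmultiples S p)" if "p \<in> B" for p
    proof -
      have "t \<le> size (nonmultiples X p)"
        using that many[of p] prime_gt_1_nat[of p] by (simp add: B_def)
      then obtain S where S: "S \<subseteq># nonmultiples X p" "size S = t"
        using ex_submset_size by blast
      \<comment> \<open>All elements of \<open>S\<close> were chosen among the non-multiples of
        \<open>p\<close>, so filtering removes none.\<close>
      then have "nonmultiples S p = S"
        unfolding nonmultiples_eq_filter filter_mset_eq_conv
        by (auto dest: mset_subset_eqD)
      moreover have "S \<subseteq># X"
        using S(1) unfolding nonmultiples_eq_filter
        by (meson multiset_filter_subset subset_mset.order_trans)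
      ultimately show ?thesis using S(2) by auto
    qed
    from ex_mset_cover[where Q = "\<lambda>p S. t \<le> size (nonmultiples S p)", OF finB R0(1) this]
    obtain R where R: "R0 \<subseteq># R" "R \<subseteq># X" "size R \<le> size R0 + card B * t"
        "\<forall>p\<in>B. \<exists>S. S \<subseteq># R \<and> t \<le> size (nonmultiples S p)"
      by blast
    have "real (size R) \<le> 2 * real t + real (card B) * real t"
      using R(3) R0(2) by (metis of_nat_add of_nat_le_iff of_nat_mult of_nat_numeral)
    also have "\<dots> \<le> 2 * real t + 4 * log 2 (real n) * real t"
      using cardB by (intro add_left_mono mult_right_mono) auto
    also have "\<dots> \<le> 4 * real t * log 2 (2 * real n)"
      unfolding log_2n by (simp add: algebra_simps)
    finally have size_R: "real (size R) \<le> 4 * real t * log 2 (2 * real n)" .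
    have "d \<le> size (nonmultiples R d)" if d: "1 < d" "d \<le> t" for d
    proof -
      obtain p where p: "prime p" "p dvd d" using prime_factor_nat[of d] d by auto
      have "p \<le> t" using dvd_imp_le[OF p(2)] d by simp
      have "\<exists>S. S \<subseteq># R \<and> t \<le> size (nonmultiples S p)"
      proof (cases "p \<in> B")
        case True
        then show ?thesis using R(4) by blast
      next
        case False
        \<comment> \<open>Since \<open>p\<close> is a prime up to \<open>t\<close> outside
          \<open>B\<close>, the sample \<open>R0\<close> already has more than \<open>t\<close>
          non-multiples of it.\<close>
        then show ?thesis using R(1) p(1) \<open>p \<le> t\<close> by (intro exI[of _ R0]) (auto simp: B_def)
      qed
      then show ?thesis using size_nonmultiples_mono[OF _ p(2)] d(2) by (meson le_trans)
    qed
    then show ?thesis using R(2) size_R by blast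
  qed
qed

section \<open>Choice of the threshold and the size bounds from density\<close>

theorem theorem4p12:
  fixes \<delta> \<alpha> :: real and X :: "nat multiset" and n :: nat
  assumes "\<delta> \<ge> 1" and "\<alpha> \<ge> 1"
    and "X \<noteq> {#}" and "\<forall>x\<in>#X. x > 0"
    and "size X = n"
    and "dense \<delta> X"
    and "\<not> (\<exists>d. almost_divisor \<alpha> X d)"
  shows "\<exists>R. R \<subseteq># X
    \<and> real (size R) \<le> real (size X) * (8 * \<alpha> * log 2 (2 * real n) / \<delta>)
    \<and> real (sum_mset R) \<le> real (sum_mset X) * (8 * \<alpha> * log 2 (2 * real n) / \<delta>)
    \<and> (\<forall>d::nat. 1 < d \<and> real d \<le> \<alpha> * real (max_mult X) * real (sum_mset X) / (real n)\<^sup>2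
          \<longrightarrow> size (nonmultiples R d) \<ge> d)"
proof -
  define m where "m = Max (set_mset X)"
  define \<mu> where "\<mu> = max_mult X"
  define \<tau> where "\<tau> = \<alpha> * real \<mu> * real (sum_mset X) / (real n)\<^sup>2"
  \<comment> \<open>Rounding down loses nothing: an integer \<open>d\<close> is at most
    \<open>\<tau>\<close> exactly when it is at most \<open>t\<close>.\<close>
  define t where "t = nat \<lfloor>\<tau>\<rfloor>"
  define L where "L = log 2 (2 * real n)"
  have n: "n > 0" using assms(3,5) by (metis nonempty_has_size)
  have L: "L \<ge> 0" using n by (simp add: L_def)
  have le_m: "x \<le> m" if "x \<in># X" for x using that by (simp add: m_def)
  have m: "m > 0" using assms(3,4) le_m by (metis gr_zeroI le_zero_eq multiset_nonemptyE)
  have \<mu>: "\<mu> \<ge> 1"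
  proof -
    obtain x where "x \<in># X" using assms(3) by blast
    then have "count X x > 0" "count X x \<le> \<mu>" by (auto simp: \<mu>_def max_mult_def)
    then show ?thesis by linarith
  qed
  have dens: "\<delta> * real \<mu> * real m \<le> (real n)\<^sup>2"
    using assms(5,6) by (simp add: dense_def \<mu>_def m_def)
  \<comment> \<open>As \<open>\<delta>\<close> and \<open>\<mu>\<close> are at least 1, density
    bounds every element by the square of \<open>n\<close>, which keeps the number of prime divisors
    logarithmic in \<open>n\<close>.\<close>
  have "real m * (1 * 1) \<le> real m * (\<delta> * real \<mu>)"
    using assms(1) \<mu> by (intro mult_left_mono mult_mono) auto
  also have "\<dots> \<le> real (n\<^sup>2)" using dens by (simp add: mult_ac)
  finally have m_le: "m \<le> n\<^sup>2" by (simp only: mult_1_right of_nat_le_iff)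
  have \<tau>0: "\<tau> \<ge> 0" unfolding \<tau>_def
    using assms(2) by (intro divide_nonneg_nonneg mult_nonneg_nonneg of_nat_0_le_iff) auto
  then have t: "real t \<le> \<tau>" unfolding t_def by linarith
  have \<tau>m: "\<tau> * real m \<le> real (sum_mset X) * (\<alpha> / \<delta>)"
  proof -
    have "(\<delta> * real \<mu> * real m) * (\<alpha> * real (sum_mset X))
        \<le> (real n)\<^sup>2 * (\<alpha> * real (sum_mset X))"
      using dens assms(2) by (intro mult_right_mono mult_nonneg_nonneg of_nat_0_le_iff) auto
    then show ?thesis using assms(1) n
      by (simp add: \<tau>_def field_simps)
  qed
  \<comment> \<open>Bounding the sum by \<open>n * m\<close> in the previous estimate lets the
    positive factor \<open>m\<close> cancel.\<close>
  have \<tau>n: "\<tau> \<le> real n * (\<alpha> / \<delta>)"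
  proof -
    have "real (sum_mset X) \<le> real n * real m"
      using sum_mset_le_size_mult[of X m] le_m assms(5) by (metis of_nat_le_iff of_nat_mult)
    then have "real (sum_mset X) * (\<alpha> / \<delta>) \<le> real n * real m * (\<alpha> / \<delta>)"
      using assms(1,2) by (intro mult_right_mono) auto
    with \<tau>m have "real m * \<tau> \<le> real m * (real n * (\<alpha> / \<delta>))" by (simp add: mult_ac)
    then show ?thesis using m by (simp only: mult_le_cancel_left_pos of_nat_0_less_iff)
  qed
  have many: "t \<le> size (nonmultiples X d)" if "d > 1" for d
  proof -
    have "\<tau> < real (size (nonmultiples X d))"
      using assms(5,7) that by (auto simp: almost_divisor_def \<tau>_def \<mu>_def not_le)
    then show ?thesis using t by linarith
  qed
  have "x > 0 \<and> x \<le> n\<^sup>2" if "x \<in># X" for x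
    using assms(4) that le_m[OF that] m_le by auto
  from ex_submset_many_nonmultiples[OF assms(5) n this many]
  obtain R where R: "R \<subseteq># X" "real (size R) \<le> 4 * real t * L"
      "\<forall>d. 1 < d \<and> d \<le> t \<longrightarrow> d \<le> size (nonmultiples R d)"
    unfolding L_def by blast
  have size_R: "real (size R) \<le> 8 * \<tau> * L"
  proof -
    have "4 * real t * L \<le> 8 * \<tau> * L" using t \<tau>0 L by (intro mult_right_mono) auto
    then show ?thesis using R(2) by linarith
  qed
  have "8 * L * \<tau> \<le> 8 * L * (real n * (\<alpha> / \<delta>))"
    using \<tau>n L by (intro mult_left_mono) auto
  then have "real (size R) \<le> real (size X) * (8 * \<alpha> * L / \<delta>)"
    using size_R assms(5) by (simp add: mult_ac)
  moreover have "real (sum_mset R) \<le> real (sum_mset X) * (8 * \<alpha> * L / \<delta>)"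
  proof -
    \<comment> \<open>Each element of \<open>R\<close> costs at most \<open>m\<close>, and
      \<open>\<tau> * m\<close> is controlled by density.\<close>
    have "sum_mset R \<le> size R * m"
      using R(1) le_m by (intro sum_mset_le_size_mult) (auto dest: mset_subset_eqD)
    then have "real (sum_mset R) \<le> real (size R) * real m"
      by (metis of_nat_le_iff of_nat_mult)
    also have "\<dots> \<le> 8 * \<tau> * L * real m" using size_R by (intro mult_right_mono) auto
    also have "\<dots> = 8 * L * (\<tau> * real m)" by simp
    also have "\<dots> \<le> 8 * L * (real (sum_mset X) * (\<alpha> / \<delta>))"
      using \<tau>m L by (intro mult_left_mono) auto
    finally show ?thesis by (simp add: mult_ac)
  qed
  moreover have "d \<le> size (nonmultiples R d)" if "1 < d" "real d \<le> \<tau>" for d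
    using R(3) that by (simp add: t_def le_nat_floor)
  ultimately show ?thesis using R(1) unfolding L_def \<tau>_def \<mu>_def by blast
qed

end
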